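(* Let $\mathcal{G}=(\mathcal{V},\mathcal{E})$ be a connected graph with $\mathcal{V}=\{1,\ldots,n\}$, and let $\{G_{ij}\}_{(i,j)\in\mathcal{E}}$ be a collection of matrices in $GL(d,\mathbb{R})$. Then $\{G_{ij}\}_{(i,j)\in\mathcal{E}}$ is transitively consistent for $\mathcal{G}$ if and only if $$\dim\bigl(\ker(H(\mathcal{G},\{G_{ij}\}_{(i,j)\in\mathcal{E}}))\bigr)=d.$$
   Context: $\mathcal{G}=(\mathcal{V},\mathcal{E})$ is a directed graph with node set $\mathcal{V}=\{1,\ldots,n\}$ and edge set $\mathcal{E}\subset\mathcal{V}\times\mathcal{V}$. The graph is connected if there is an undirected path from any node to any other node, i.e. a finite sequence of unique nodes such that for any pair $(i,j)$ of consecutive nodes, $(i,j)\in\mathcal{E}$ or $(j,i)\in\mathcal{E}$. Transitive consistency: a collection $\{G_{ij}\}_{(i,j)\in\mathcal{V}\times\mathcal{V}}$ in $GL(d,\mathbb{R})$ is transitively consistent for the complete graph if $G_{ik}=G_{ij}G_{jk}$ for all $i,j,k$. A collection $\{G_{ij}\}_{(i,j)\in\mathcal{E}}$ in $GL(d,\mathbb{R})$ is transitively consistent for $\mathcal{G}$ if it can be extended to a collection $\{G_{ij}\}_{(i,j)\in\mathcal{V}\times\mathcal{V}}$ in $GL(d,\mathbb{R})$ that is transitively consistent for the complete graph. The matrix $H$: let $A$ be the adjacency matrix ($A_{ij}=1$ if $(i,j)\in\mathcal{E}$, $0$ otherwise). Let $W(\mathcal{G},\{G_{ij}\})\in\mathbb{R}^{nd\times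 nd}$ be the block matrix whose $(i,j)$ block of size $d\times d$ is $G_{ij}$ if $(i,j)\in\mathcal{E}$ and $0$ otherwise, and let $Z(\mathcal{G},\{G_{ij}\})=\mathrm{diag}(A\,1_n)\otimes I_d-W(\mathcal{G},\{G_{ij}\})$, with $1_n$ the all-ones vector. Let $\bar{\mathcal{G}}=(\mathcal{V},\bar{\mathcal{E}})$ be $\mathcal{G}$ with all edges reversed and $\bar G_{ij}=G_{ji}^T$ for $(i,j)\in\bar{\mathcal{E}}$. Put $\bar W=W(\bar{\mathcal{G}},\{\bar G_{ij}\}_{(i,j)\in\bar{\mathcal{E}}})$ and $Z_2=\mathrm{diag}(\bar W\bar W^T)-\bar W$, where here $\mathrm{diag}(B)$ keeps the $d\times d$ diagonal blocks of $B\in\mathbb{R}^{nd\times nd}$ and sets all other blocks to zero. Then $H(\mathcal{G},\{G_{ij}\}_{(i,j)\in\mathcal{E}})=Z(\mathcal{G},\{G_{ij}\})+Z_2$. *)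

theory Defs
  imports "HOL-Analysis.Analysis"
begin

text \<open>
  The node set \<open>{1, \<dots>, n}\<close> is rendered as a finite type \<open>'n\<close>, and a graph is its edge set
  \<open>E :: ('n \<times> 'n) set\<close>; self-loops and antiparallel edges are allowed.  A family indexed by \<open>E\<close> is
  a total function \<open>G :: 'n \<Rightarrow> 'n \<Rightarrow> real ^ 'd ^ 'd\<close>; every definition below reads only
  the values \<open>G i j\<close> with \<open>(i, j) \<in> E\<close>.  Square matrices of size \<open>nd\<close> are indexed by
  \<open>'n \<times> 'd\<close>, the first component selecting the block.
\<close>

definition undirected_path :: "('n \<times> 'n) set \<Rightarrow> 'n \<Rightarrow> 'n list \<Rightarrow> 'n \<Rightarrow> bool" where
  "undirected_path E i p j \<longleftrightarrow>
     p \<noteq> [] \<and> hd p = i \<and> last p = j \<and> distinct p \<and>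
     (\<forall>k. Suc k < length p \<longrightarrow> (p ! k, p ! Suc k) \<in> E \<or> (p ! Suc k, p ! k) \<in> E)"

definition graph_connected :: "('n \<times> 'n) set \<Rightarrow> bool" where
  "graph_connected E \<longleftrightarrow> (\<forall>i j. i \<noteq> j \<longrightarrow> (\<exists>p. undirected_path E i p j))"

definition GL_family :: "('n \<times> 'n) set \<Rightarrow> ('n \<Rightarrow> 'n \<Rightarrow> real ^ 'd ^ 'd) \<Rightarrow> bool" where
  "GL_family E G \<longleftrightarrow> (\<forall>(i, j) \<in> E. invertible (G i j))"

definition transitively_consistent_complete :: "('n \<Rightarrow> 'n \<Rightarrow> real ^ 'd ^ 'd) \<Rightarrow> bool" where
  "transitively_consistent_complete G \<longleftrightarrow> (\<forall>i j k. G i k = G i j ** G j k)"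

definition transitively_consistent ::
    "('n \<times> 'n) set \<Rightarrow> ('n \<Rightarrow> 'n \<Rightarrow> real ^ 'd ^ 'd) \<Rightarrow> bool" where
  "transitively_consistent E G \<longleftrightarrow>
     (\<exists>F. GL_family UNIV F \<and> (\<forall>(i, j) \<in> E. F i j = G i j) \<and>
          transitively_consistent_complete F)"

definition adjacency :: "('n \<times> 'n) set \<Rightarrow> real ^ 'n ^ 'n" where
  "adjacency E = (\<chi> i j. if (i, j) \<in> E then 1 else 0)"

definition diag_of_vec :: "real ^ 'n \<Rightarrow> real ^ 'n ^ 'n" where
  "diag_of_vec v = (\<chi> i j. if i = j then v $ i else 0)"

definition kronecker ::
    "real ^ 'n ^ 'n \<Rightarrow> real ^ 'd ^ 'd \<Rightarrow> real ^ ('n \<times> 'd) ^ ('n \<times> 'd)" where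
  "kronecker A B = (\<chi> p q. A $ fst p $ fst q * B $ snd p $ snd q)"

definition block_matrix ::
    "('n::finite \<Rightarrow> 'n \<Rightarrow> real ^ 'd ^ 'd) \<Rightarrow> real ^ ('n \<times> 'd) ^ ('n \<times> 'd)" where
  "block_matrix B = (\<chi> p q. B (fst p) (fst q) $ snd p $ snd q)"

definition block_diag ::
    "real ^ ('n::finite \<times> 'd::finite) ^ ('n \<times> 'd) \<Rightarrow> real ^ ('n \<times> 'd) ^ ('n \<times> 'd)" where
  "block_diag B = (\<chi> p q. if fst p = fst q then B $ p $ q else 0)"

definition W_matrix ::
    "('n::finite \<times> 'n) set \<Rightarrow> ('n \<Rightarrow> 'n \<Rightarrow> real ^ 'd ^ 'd) \<Rightarrow> real ^ ('n \<times> 'd) ^ ('n \<times> 'd)" where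
  "W_matrix E G = block_matrix (\<lambda>i j. if (i, j) \<in> E then G i j else 0)"

text \<open>In \<open>adjacency E *v 1\<close> the \<open>1\<close> is the all-ones vector, whereas \<open>mat 1\<close> is the identity matrix.\<close>

definition Z_matrix ::
    "('n::finite \<times> 'n) set \<Rightarrow> ('n \<Rightarrow> 'n \<Rightarrow> real ^ 'd ^ 'd) \<Rightarrow> real ^ ('n \<times> 'd) ^ ('n \<times> 'd)" where
  "Z_matrix E G = kronecker (diag_of_vec (adjacency E *v 1)) (mat 1) - W_matrix E G"

definition W_bar ::
    "('n::finite \<times> 'n) set \<Rightarrow> ('n \<Rightarrow> 'n \<Rightarrow> real ^ 'd ^ 'd) \<Rightarrow> real ^ ('n \<times> 'd) ^ ('n \<times> 'd)" where
  "W_bar E G = W_matrix (E\<inverse>) (\<lambda>i j. transpose (G j i))"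

definition Z2_matrix ::
    "('n::finite \<times> 'n) set \<Rightarrow> ('n \<Rightarrow> 'n \<Rightarrow> real ^ 'd ^ 'd) \<Rightarrow> real ^ ('n \<times> 'd) ^ ('n \<times> 'd)" where
  "Z2_matrix E G = block_diag (W_bar E G ** transpose (W_bar E G)) - W_bar E G"

definition H_matrix ::
    "('n::finite \<times> 'n) set \<Rightarrow> ('n \<Rightarrow> 'n \<Rightarrow> real ^ 'd ^ 'd) \<Rightarrow> real ^ ('n \<times> 'd) ^ ('n \<times> 'd)" where
  "H_matrix E G = Z_matrix E G + Z2_matrix E G"

definition matrix_kernel :: "real ^ 'm ^ 'm \<Rightarrow> (real ^ 'm) set" where
  "matrix_kernel M = {x. M *v x = 0}"

end

theory Submission
  imports Defs
begin

text \<open>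
  Write \<open>x\<^sub>i\<close> for the block of a vector \<open>x\<close> at the node \<open>i\<close>.  The second summand of \<open>H\<close> makes
  its quadratic form a sum of squares, one for each edge:
  \<open>x \<bullet> H x = (\<Sum>(i,j)\<in>E. \<parallel>x\<^sub>i - G\<^sub>i\<^sub>j x\<^sub>j\<parallel>\<^sup>2)\<close> (lemma \<open>inner_H_matrix_eq_sum_squares\<close>).  Hence the
  kernel of \<open>H\<close> is the space of compatible vectors, those with \<open>x\<^sub>i = G\<^sub>i\<^sub>j x\<^sub>j\<close> along every edge
  (lemma \<open>matrix_kernel_H_matrix\<close>); although \<open>H\<close> need not be symmetric, vanishing of the
  quadratic form at \<open>x\<close> gives \<open>H x = 0\<close>, because every summand of \<open>H x\<close> contains one of these
  edge residuals.

  Since the graph is connected and the \<open>G\<^sub>i\<^sub>j\<close> are invertible, a compatible vector is determined by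
  its value at any single node \<open>r\<close>.  So the kernel has dimension at most \<open>d\<close>, and it has dimension
  \<open>d\<close> exactly if every vector of \<open>\<real>\<^sup>d\<close> occurs as the value at \<open>r\<close> of a compatible vector
  (lemma \<open>dim_compatible_eq_iff\<close>).  If \<open>F\<close> is a transitively consistent extension of \<open>G\<close>, then
  the vector with blocks \<open>F\<^sub>i\<^sub>r v\<close> is compatible with value \<open>v\<close> at \<open>r\<close>.  Conversely, if evaluation
  at each node is a bijection from the kernel to \<open>\<real>\<^sup>d\<close>, then transporting values from node \<open>j\<close> to
  node \<open>i\<close> through the kernel defines matrices \<open>F\<^sub>i\<^sub>j\<close>, which are consistent for trivial reasons
  and extend \<open>G\<close>.
\<close>

section \<open>Blocks of vectors and matrices\<close>

definition vec_block :: "real ^ ('n::finite \<times> 'd::finite) \<Rightarrow> 'n \<Rightarrow> real ^ 'd" where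
  "vec_block x i = (\<chi> a. x $ (i, a))"

definition mat_block ::
    "real ^ ('n::finite \<times> 'd::finite) ^ ('n \<times> 'd) \<Rightarrow> 'n \<Rightarrow> 'n \<Rightarrow> real ^ 'd ^ 'd" where
  "mat_block M i j = (\<chi> a b. M $ (i, a) $ (j, b))"

lemma linear_vec_block: "linear (\<lambda>x. vec_block x i)"
  by (rule linearI) (simp_all add: vec_block_def vec_eq_iff)

lemma vec_block_eqI:
  assumes "\<And>i. vec_block x i = vec_block y i"
  shows "x = y"
  using assms by (auto simp: vec_block_def vec_eq_iff)

lemma inner_eq_sum_vec_block: "x \<bullet> y = (\<Sum>i\<in>UNIV. vec_block x i \<bullet> vec_block y i)"
  by (simp add: inner_vec_def vec_block_def sum.cartesian_product)

lemma vec_block_matrix_vector_mult: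
  "vec_block (M *v x) i = (\<Sum>j\<in>UNIV. mat_block M i j *v vec_block x j)"
  by (simp add: vec_eq_iff vec_block_def mat_block_def matrix_vector_mult_def
      sum.cartesian_product)

lemma mat_block_matrix_mult:
  "mat_block (A ** B) i j = (\<Sum>k\<in>UNIV. mat_block A i k ** mat_block B k j)"
  by (simp add: vec_eq_iff mat_block_def matrix_matrix_mult_def sum.cartesian_product)

lemma mat_block_transpose: "mat_block (transpose A) i j = transpose (mat_block A j i)"
  by (simp add: vec_eq_iff mat_block_def transpose_def)

lemma mat_block_diff: "mat_block (A - B) i j = mat_block A i j - mat_block B i j"
  by (simp add: vec_eq_iff mat_block_def)

lemma mat_block_W_matrix: "mat_block (W_matrix E G) i j = (if (i, j) \<in> E then G i j else 0)"
  by (simp add: vec_eq_iff mat_block_def W_matrix_def block_matrix_def)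

lemma mat_block_block_diag:
  "mat_block (block_diag B) i j = (if i = j then mat_block B i i else 0)"
  by (simp add: vec_eq_iff mat_block_def block_diag_def)

lemma mat_block_degree:
  "mat_block (kronecker (diag_of_vec (adjacency E *v 1)) (mat 1)) i j =
     (if i = j then real (card {k. (i, k) \<in> E}) *\<^sub>R mat 1 else 0)"
proof -
  have "(adjacency E *v 1) $ i = real (card {k. (i, k) \<in> E})" for i
    by (simp add: adjacency_def matrix_vector_mult_def sum.If_cases)
  then show ?thesis
    by (simp add: vec_eq_iff mat_block_def kronecker_def diag_of_vec_def)
qed

section \<open>The matrix \<open>H\<close> as a sum of edge residuals\<close>

lemma sum_matrix_vector_mult: "(\<Sum>k\<in>S. f k :: real ^ 'a ^ 'b) *v x = (\<Sum>k\<in>S. f k *v x)"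
  by (induction S rule: infinite_finite_induct) (simp_all add: matrix_vector_mult_add_rdistrib)

lemma vec_block_Z_matrix:
  "vec_block (Z_matrix E G *v x) i =
     (\<Sum>j | (i, j) \<in> E. vec_block x i - G i j *v vec_block x j)"
proof -
  have "vec_block (Z_matrix E G *v x) i =
      (\<Sum>j\<in>UNIV. (if i = j then real (card {k. (i, k) \<in> E}) *\<^sub>R vec_block x j else 0)
         - (if (i, j) \<in> E then G i j *v vec_block x j else 0))"
    unfolding vec_block_matrix_vector_mult
    by (intro sum.cong)
       (auto simp: Z_matrix_def mat_block_diff mat_block_degree mat_block_W_matrix
         matrix_vector_mult_diff_rdistrib scaleR_matrix_vector_assoc[symmetric])
  then show ?thesis
    by (simp add: sum_subtractf sum.If_cases sum_constant_scaleR del: sum_constant)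
qed

lemma vec_block_Z2_matrix:
  "vec_block (Z2_matrix E G *v x) i =
     (\<Sum>j | (j, i) \<in> E. transpose (G j i) *v (G j i *v vec_block x i - vec_block x j))"
proof -
  have diag: "mat_block (W_bar E G ** transpose (W_bar E G)) i i =
      (\<Sum>j | (j, i) \<in> E. transpose (G j i) ** G j i)"
    unfolding mat_block_matrix_mult
    by (rule sum.mono_neutral_cong_right)
       (auto simp: mat_block_transpose W_bar_def mat_block_W_matrix)
  have "vec_block (Z2_matrix E G *v x) i =
      (\<Sum>j\<in>UNIV. (if i = j then mat_block (W_bar E G ** transpose (W_bar E G)) i i *v vec_block x j
            else 0)
         - (if (j, i) \<in> E then transpose (G j i) *v vec_block x j else 0))"
    unfolding vec_block_matrix_vector_mult
    by (intro sum.cong)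
       (auto simp: Z2_matrix_def mat_block_diff mat_block_block_diag
         mat_block_W_matrix W_bar_def matrix_vector_mult_diff_rdistrib)
  then show ?thesis
    by (simp add: diag sum_subtractf sum.If_cases sum_matrix_vector_mult
        matrix_vector_mult_diff_distrib matrix_vector_mul_assoc)
qed

lemma vec_block_H_matrix:
  "vec_block (H_matrix E G *v x) i =
     (\<Sum>j | (i, j) \<in> E. vec_block x i - G i j *v vec_block x j) +
     (\<Sum>j | (j, i) \<in> E. transpose (G j i) *v (G j i *v vec_block x i - vec_block x j))"
  by (simp add: H_matrix_def matrix_vector_mult_add_rdistrib linear_add[OF linear_vec_block]
      vec_block_Z_matrix vec_block_Z2_matrix)

lemma inner_transpose_mult: "a \<bullet> (transpose A *v w) = (A *v a) \<bullet> (w :: real ^ 'm)"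
  using dot_lmul_matrix[of w A a] by (simp add: inner_commute)

text \<open>
  The edge \<open>(i, j)\<close> contributes its residual \<open>r = x\<^sub>i - G\<^sub>i\<^sub>j x\<^sub>j\<close> twice: paired with \<open>x\<^sub>i\<close> in the row of
  \<open>i\<close>, and as \<open>- G\<^sub>i\<^sub>j\<^sup>T r\<close> paired with \<open>x\<^sub>j\<close> in the row of \<open>j\<close>.  The two together give \<open>r \<bullet> r\<close>.
\<close>

lemma inner_H_matrix_eq_sum_squares:
  "x \<bullet> (H_matrix E G *v x) =
     (\<Sum>(i, j)\<in>E. (norm (vec_block x i - G i j *v vec_block x j))\<^sup>2)"
proof -
  define r where "r i j = vec_block x i - G i j *v vec_block x j" for i j
  have row: "vec_block x i \<bullet> vec_block (H_matrix E G *v x) i =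
      (\<Sum>j\<in>UNIV. if (i, j) \<in> E then vec_block x i \<bullet> r i j else 0) -
      (\<Sum>j\<in>UNIV. if (j, i) \<in> E then (G j i *v vec_block x i) \<bullet> r j i else 0)" for i
  proof -
    have "vec_block x i \<bullet> (transpose (G j i) *v (G j i *v vec_block x i - vec_block x j)) =
        - ((G j i *v vec_block x i) \<bullet> r j i)" for j
      unfolding inner_transpose_mult r_def by (simp add: inner_diff_right)
    then show ?thesis
      unfolding vec_block_H_matrix inner_add_right inner_sum_right r_def[symmetric]
      by (simp add: sum.If_cases sum_negf del: transpose_matrix_vector)
  qed
  have "x \<bullet> (H_matrix E G *v x) =
      (\<Sum>i\<in>UNIV. \<Sum>j\<in>UNIV. if (i, j) \<in> E then vec_block x i \<bullet> r i j else 0) -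
      (\<Sum>j\<in>UNIV. \<Sum>i\<in>UNIV. if (i, j) \<in> E then (G i j *v vec_block x j) \<bullet> r i j else 0)"
    by (simp add: inner_eq_sum_vec_block row sum_subtractf)
  also have "\<dots> = (\<Sum>i\<in>UNIV. \<Sum>j\<in>UNIV. if (i, j) \<in> E then r i j \<bullet> r i j else 0)"
    by (subst (2) sum.swap)
       (auto simp: r_def inner_diff_left sum_subtractf[symmetric] intro!: sum.cong)
  also have "\<dots> = (\<Sum>(i, j)\<in>E. r i j \<bullet> r i j)"
    unfolding sum.cartesian_product by (rule sum.mono_neutral_cong_right) auto
  finally show ?thesis
    by (simp add: r_def power2_norm_eq_inner)
qed

section \<open>Compatible vectors\<close>

definition compatible ::
    "('n::finite \<times> 'n) set \<Rightarrow> ('n \<Rightarrow> 'n \<Rightarrow> real ^ 'd ^ 'd) \<Rightarrow> (real ^ ('n \<times> 'd::finite)) set" where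
  "compatible E G = {x. \<forall>(i, j)\<in>E. vec_block x i = G i j *v vec_block x j}"

lemma matrix_kernel_H_matrix: "matrix_kernel (H_matrix E G) = compatible E G"
proof (intro equalityI subsetI)
  fix x assume "x \<in> matrix_kernel (H_matrix E G)"
  then have "(\<Sum>(i, j)\<in>E. (norm (vec_block x i - G i j *v vec_block x j))\<^sup>2) = 0"
    by (simp add: matrix_kernel_def flip: inner_H_matrix_eq_sum_squares)
  then show "x \<in> compatible E G"
    by (subst (asm) sum_nonneg_eq_0_iff) (auto simp: compatible_def)
next
  fix x assume "x \<in> compatible E G"
  then have "vec_block (H_matrix E G *v x) i = vec_block 0 i" for i
    unfolding vec_block_H_matrix linear_0[OF linear_vec_block]
    by (subst (1 2) sum.neutral) (auto simp: compatible_def)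
  then show "x \<in> matrix_kernel (H_matrix E G)"
    by (auto simp: matrix_kernel_def intro: vec_block_eqI)
qed

lemma subspace_compatible: "subspace (compatible E G)"
  unfolding subspace_def compatible_def
  by (fastforce simp: linear_0[OF linear_vec_block] linear_add[OF linear_vec_block]
      linear_scale[OF linear_vec_block] matrix_vector_right_distrib matrix_vector_mult_scaleR)

lemma graph_connected_induct:
  assumes "graph_connected E" and "P r"
    and edge: "\<And>i j. (i, j) \<in> E \<Longrightarrow> P i \<longleftrightarrow> P j"
  shows "P j"
proof (cases "r = j")
  case False
  then obtain p where p: "p \<noteq> []" "hd p = r" "last p = j"
    "\<And>k. Suc k < length p \<Longrightarrow> (p ! k, p ! Suc k) \<in> E \<or> (p ! Suc k, p ! k) \<in> E"
    using assms(1) unfolding graph_connected_def undirected_path_def by metis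
  have "k < length p \<Longrightarrow> P (p ! k)" for k
  proof (induction k)
    case 0
    then show ?case using p \<open>P r\<close> by (simp add: hd_conv_nth)
  next
    case (Suc k)
    then show ?case using p(4)[of k] edge by auto
  qed
  then show ?thesis
    using p by (metis diff_less last_conv_nth length_greater_0_conv zero_less_one)
qed (use assms in simp)

text \<open>Vanishing at a node spreads along edges in both directions, because the \<open>G\<^sub>i\<^sub>j\<close> are injective.\<close>

lemma inj_on_vec_block_compatible:
  assumes "graph_connected E" and "GL_family E G"
  shows "inj_on (\<lambda>x. vec_block x r) (compatible E G)"
proof (subst linear_inj_on_iff_eq_0[OF linear_vec_block subspace_compatible], intro ballI impI)
  fix x assume x: "x \<in> compatible E G" and "vec_block x r = 0"
  have "vec_block x i = 0" for i
  proof (rule graph_connected_induct[where P = "\<lambda>i. vec_block x i = 0"])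
    fix i j assume "(i, j) \<in> E"
    then have "vec_block x i = G i j *v vec_block x j" and "invertible (G i j)"
      using x assms(2) by (auto simp: compatible_def GL_family_def)
    then show "vec_block x i = 0 \<longleftrightarrow> vec_block x j = 0"
      using injD[OF inj_matrix_vector_mult[of "G i j"], of "vec_block x j" 0] by auto
  qed fact+
  then show "x = 0"
    by (intro vec_block_eqI) (simp add: linear_0[OF linear_vec_block])
qed

lemma dim_compatible_eq_iff:
  fixes G :: "'n::finite \<Rightarrow> 'n \<Rightarrow> real ^ 'd::finite ^ 'd"
  assumes "graph_connected E" and "GL_family E G"
  shows "dim (compatible E G) = CARD('d) \<longleftrightarrow> (\<lambda>x. vec_block x r) ` compatible E G = UNIV"
proof -
  let ?V = "(\<lambda>x. vec_block x r) ` compatible E G"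
  have "dim ?V = dim (compatible E G)"
    using inj_on_vec_block_compatible[OF assms, of r]
    by (intro dim_image_eq linear_vec_block) (simp add: span_eq_iff[THEN iffD2] subspace_compatible)
  moreover have "span ?V = ?V"
    by (simp add: span_eq_iff linear_subspace_image linear_vec_block subspace_compatible)
  ultimately show ?thesis
    using dim_eq_full[of ?V] by (simp del: span_eq_iff)
qed

section \<open>Compatible vectors and consistent extensions\<close>

lemma vec_block_compatible_surj_of_consistent:
  fixes G :: "'n::finite \<Rightarrow> 'n \<Rightarrow> real ^ 'd::finite ^ 'd"
  assumes "transitively_consistent E G"
  shows "(\<lambda>x. vec_block x r) ` compatible E G = UNIV"
proof -
  obtain F where inv: "GL_family UNIV F" and ext: "\<forall>(i, j)\<in>E. F i j = G i j"
    and trans: "\<And>i j k. F i k = F i j ** F j k"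
    using assms unfolding transitively_consistent_def transitively_consistent_complete_def by blast
  \<comment> \<open>\<open>F r r\<close> is idempotent by transitivity, and an invertible idempotent is the identity.\<close>
  have "F r r = mat 1"
  proof -
    obtain B where "F r r ** B = mat 1"
      using inv by (auto simp: GL_family_def invertible_def)
    moreover have "F r r ** (F r r ** B) = F r r ** B"
      by (simp add: matrix_mul_assoc trans[symmetric])
    ultimately show ?thesis
      by simp
  qed
  show ?thesis
  proof (intro equalityI subsetI)
    fix v :: "real ^ 'd"
    define x where "x = (\<chi> p. (F (fst p) r *v v) $ snd p)"
    have x: "vec_block x i = F i r *v v" for i
      by (simp add: x_def vec_block_def vec_eq_iff)
    have "x \<in> compatible E G"
      unfolding compatible_def
    proof (clarify, simp only: x)
      fix i j assume "(i, j) \<in> E"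
      then have "G i j = F i j"
        using ext by auto
      then show "F i r *v v = G i j *v (F j r *v v)"
        by (simp add: matrix_vector_mul_assoc trans[symmetric])
    qed
    moreover have "v = vec_block x r"
      by (simp add: x \<open>F r r = mat 1\<close>)
    ultimately show "v \<in> (\<lambda>x. vec_block x r) ` compatible E G"
      by blast
  qed simp
qed

text \<open>
  A value at node \<open>j\<close> extends to exactly one compatible vector, and the matrix sending it to the value
  of that vector at \<open>i\<close> is the extension at \<open>(i, j)\<close>.  Going from \<open>k\<close> to \<open>i\<close> by way of \<open>j\<close> stays
  within one compatible vector, which gives consistency; compatibility along an edge says that the
  transport there is \<open>G\<^sub>i\<^sub>j\<close>.
\<close>

lemma consistent_of_vec_block_compatible_bij:
  fixes G :: "'n::finite \<Rightarrow> 'n \<Rightarrow> real ^ 'd::finite ^ 'd"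
  assumes inj: "\<And>r. inj_on (\<lambda>x. vec_block x r) (compatible E G)"
    and surj: "\<And>r. (\<lambda>x. vec_block x r) ` compatible E G = UNIV"
  shows "transitively_consistent E G"
proof -
  have "\<exists>s. linear s \<and> range s \<subseteq> compatible E G \<and> (\<forall>v. vec_block (s v) r = v)" for r
    using linear_exists_right_inverse_on[OF linear_vec_block subspace_compatible[of E G], of r]
    by (auto simp: surj)
  then obtain s where lin: "\<And>r. linear (s r)" and mem: "\<And>r v. s r v \<in> compatible E G"
    and right: "\<And>r v. vec_block (s r v) r = v"
    by (metis rangeI subsetD)
  have left: "s r (vec_block x r) = x" if "x \<in> compatible E G" for r x
    using inj_onD[OF inj _ mem that] right by blast
  define F where "F i j = matrix (\<lambda>v. vec_block (s j v) i)" for i j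
  have F: "F i j *v v = vec_block (s j v) i" for i j v
    unfolding F_def using linear_compose[OF lin linear_vec_block]
    by (simp add: matrix_works o_def)
  have trans: "F i k = F i j ** F j k" for i j k
    by (simp add: matrix_eq F left[OF mem] flip: matrix_vector_mul_assoc)
  have id: "F i i = mat 1" for i
    by (simp add: matrix_eq F right)
  then have "invertible (F i j)" for i j
    unfolding invertible_def by (intro exI[of _ "F j i"]) (simp add: trans[symmetric])
  moreover have "F i j = G i j" if "(i, j) \<in> E" for i j
  proof -
    have "F i j *v v = G i j *v v" for v
      using mem[of j v] that by (auto simp: F compatible_def right)
    then show ?thesis
      by (simp add: matrix_eq)
  qed
  ultimately show ?thesis
    unfolding transitively_consistent_def transitively_consistent_complete_def GL_family_def
    using trans by blast
qed

theorem proposition20: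
  fixes E :: "('n::finite \<times> 'n) set"
    and G :: "'n \<Rightarrow> 'n \<Rightarrow> real ^ 'd::finite ^ 'd"
  assumes "graph_connected E"
    and "GL_family E G"
  shows "transitively_consistent E G \<longleftrightarrow> dim (matrix_kernel (H_matrix E G)) = CARD('d)"
  unfolding matrix_kernel_H_matrix
  using dim_compatible_eq_iff[OF assms] inj_on_vec_block_compatible[OF assms]
    vec_block_compatible_surj_of_consistent consistent_of_vec_block_compatible_bij
  by metis

end
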